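(* The subfit round $\vee$-semilattices form a category with $\vee$-relations as morphisms: for $\vee$-relations $\sqsubset\ \subseteq S\times S'$ and $\sqsubset'\ \subseteq S'\times S''$ between subfit round $\vee$-semilattices, the relational composition $$\{(s,s'')\in S\times S'':\exists s'\in S'\ (s\sqsubset s'\text{ and }s'\sqsubset's'')\}$$ is again a $\vee$-relation, and for each subfit round $\vee$-semilattice $S$ the order relation $\leq$ on $S$ is a $\vee$-relation which acts as the identity morphism of $S$.
   Context: A $\vee$-semilattice is a non-empty poset in which any two elements $p,q$ have a supremum $p\vee q$. A non-empty finite $F\subseteq S$ is far if for all $p,q\in S$: if $p\leq q\vee f$ for all $f\in F$, then $p\leq q$. The rather below relation is defined by: $p\prec q$ (also written $q\succ p$) iff for all $s\in S$ with $s\nleq q$ there is a finite $F\subseteq S$ such that $F\cup\{p\}$ is far and $s\leq f\vee q$ for all $f\in F$. $S$ is round if for every $p\in S$ there is $q\in S$ with $p\prec q$. $S$ is subfit if for all $p,q\in S$: $p\nleq q$ iff for every $p'\geq p$ there is $q'\geq q$ with $p\vee q'\geq p'$ and $p'\nleq q'$. For finite $E\subseteq S$ and $q\in S$, the formal expression $\bigwedge E\leq q$ means: for all $a,b\in S$, if $a\leq b\vee e$ for all $e\in E$ then $a\leq b\vee q$. Let $S,S'$ be subfit round $\vee$-semilattices and $\sqsubset\ \subseteq S\times S'$. For $F\subseteq S$ and $F'\subseteq S'$, write $F\sqsubset F'$ if for every $f\in F$ there is $f'\in F'$ with $f\sqsubset f'$, and write $F'\sqsupset F$ if for every $f'\in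 F'$ there is $f\in F$ with $f\sqsubset f'$. The relation $\sqsubset$ is a $\vee$-relation if: (Auxiliary) for all $p,q\in S$ and $p',q'\in S'$: $p\leq q\sqsubset q'\leq p'$ implies $p\sqsubset p'$; ($\vee$-Preserving) for all $p,q\in S$ and $r'\in S'$: $p\sqsubset r'$ and $q\sqsubset r'$ imply $p\vee q\sqsubset r'$; (Decomposition) for all $p,q\in S$ and finite $F'\subseteq S'$: if $p\prec p\vee q$ and $p\sqsubset\bigvee F'$, then there is a finite $F\subseteq S$ with $F\sqsubset F'$ and $p\leq q\vee\bigvee F$; (Complementation) for all $p,q\in S$ and $p',q'\in S'$ with $p\prec p\vee q$ and $p\sqsubset p'$, there is a finite $F'\subseteq S'$ such that $q'\leq p'\vee f'$ for all $f'\in F'$, and $\bigwedge(F\cup\{p\})\leq q$ for every finite $F\subseteq S$ with $F'\sqsupset F$. In (Decomposition), if $F=\emptyset$ then $q\vee\bigvee F$ means $q$, and the case $F'=\emptyset$ is considered only when $S'$ has a minimum, which is then $\bigvee\emptyset$. *)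

theory Defs
  imports "HOL-Algebra.Lattice"
begin

definition vee_semilattice :: "('a, 'b) gorder_scheme \<Rightarrow> bool" where
  "vee_semilattice S \<longleftrightarrow> upper_semilattice S \<and> carrier S \<noteq> {}"

definition far :: "('a, 'b) gorder_scheme \<Rightarrow> 'a set \<Rightarrow> bool" where
  "far S F \<longleftrightarrow> F \<noteq> {} \<and> finite F \<and> F \<subseteq> carrier S \<and>
     (\<forall>p\<in>carrier S. \<forall>q\<in>carrier S.
        (\<forall>f\<in>F. p \<sqsubseteq>\<^bsub>S\<^esub> q \<squnion>\<^bsub>S\<^esub> f) \<longrightarrow> p \<sqsubseteq>\<^bsub>S\<^esub> q)"

text \<open>The witness \<open>F\<close> may be empty here: then \<open>{p}\<close> itself has to be far.\<close>

definition rather_below :: "('a, 'b) gorder_scheme \<Rightarrow> 'a \<Rightarrow> 'a \<Rightarrow> bool" where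
  "rather_below S p q \<longleftrightarrow>
     (\<forall>s\<in>carrier S. \<not> s \<sqsubseteq>\<^bsub>S\<^esub> q \<longrightarrow>
        (\<exists>F. finite F \<and> F \<subseteq> carrier S \<and> far S (F \<union> {p}) \<and>
             (\<forall>f\<in>F. s \<sqsubseteq>\<^bsub>S\<^esub> f \<squnion>\<^bsub>S\<^esub> q)))"

definition round_semilattice :: "('a, 'b) gorder_scheme \<Rightarrow> bool" where
  "round_semilattice S \<longleftrightarrow> (\<forall>p\<in>carrier S. \<exists>q\<in>carrier S. rather_below S p q)"

definition subfit :: "('a, 'b) gorder_scheme \<Rightarrow> bool" where
  "subfit S \<longleftrightarrow>
     (\<forall>p\<in>carrier S. \<forall>q\<in>carrier S.
        \<not> p \<sqsubseteq>\<^bsub>S\<^esub> q \<longleftrightarrow>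
        (\<forall>p'\<in>carrier S. p \<sqsubseteq>\<^bsub>S\<^esub> p' \<longrightarrow>
           (\<exists>q'\<in>carrier S. q \<sqsubseteq>\<^bsub>S\<^esub> q' \<and> p' \<sqsubseteq>\<^bsub>S\<^esub> p \<squnion>\<^bsub>S\<^esub> q' \<and> \<not> p' \<sqsubseteq>\<^bsub>S\<^esub> q')))"

definition subfit_round_semilattice :: "('a, 'b) gorder_scheme \<Rightarrow> bool" where
  "subfit_round_semilattice S \<longleftrightarrow> vee_semilattice S \<and> subfit S \<and> round_semilattice S"

text \<open>The formal inequality \<open>\<And>E \<le> q\<close>; no infimum of \<open>E\<close> is assumed to exist.\<close>

definition formal_meet_le :: "('a, 'b) gorder_scheme \<Rightarrow> 'a set \<Rightarrow> 'a \<Rightarrow> bool" where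
  "formal_meet_le S E q \<longleftrightarrow>
     (\<forall>a\<in>carrier S. \<forall>b\<in>carrier S.
        (\<forall>e\<in>E. a \<sqsubseteq>\<^bsub>S\<^esub> b \<squnion>\<^bsub>S\<^esub> e) \<longrightarrow> a \<sqsubseteq>\<^bsub>S\<^esub> b \<squnion>\<^bsub>S\<^esub> q)"

text \<open>\<open>q \<or> \<Or>F\<close> for finite \<open>F\<close>, read as \<open>q\<close> when \<open>F\<close> is empty, whether or not \<open>S\<close> has a minimum.\<close>

definition join_finite :: "('a, 'b) gorder_scheme \<Rightarrow> 'a \<Rightarrow> 'a set \<Rightarrow> 'a" where
  "join_finite S q F = (if F = {} then q else q \<squnion>\<^bsub>S\<^esub> (\<Squnion>\<^bsub>S\<^esub>F))"

definition refines :: "('a \<times> 'b) set \<Rightarrow> 'a set \<Rightarrow> 'b set \<Rightarrow> bool" where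
  "refines R F F' \<longleftrightarrow> (\<forall>f\<in>F. \<exists>f'\<in>F'. (f, f') \<in> R)"

definition corefines :: "('a \<times> 'b) set \<Rightarrow> 'b set \<Rightarrow> 'a set \<Rightarrow> bool" where
  "corefines R F' F \<longleftrightarrow> (\<forall>f'\<in>F'. \<exists>f\<in>F. (f, f') \<in> R)"

definition auxiliary ::
    "('a, 'c) gorder_scheme \<Rightarrow> ('b, 'd) gorder_scheme \<Rightarrow> ('a \<times> 'b) set \<Rightarrow> bool" where
  "auxiliary S S' R \<longleftrightarrow>
     (\<forall>p\<in>carrier S. \<forall>q\<in>carrier S. \<forall>p'\<in>carrier S'. \<forall>q'\<in>carrier S'.
        p \<sqsubseteq>\<^bsub>S\<^esub> q \<and> (q, q') \<in> R \<and> q' \<sqsubseteq>\<^bsub>S'\<^esub> p' \<longrightarrow> (p, p') \<in> R)"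

definition vee_preserving ::
    "('a, 'c) gorder_scheme \<Rightarrow> ('b, 'd) gorder_scheme \<Rightarrow> ('a \<times> 'b) set \<Rightarrow> bool" where
  "vee_preserving S S' R \<longleftrightarrow>
     (\<forall>p\<in>carrier S. \<forall>q\<in>carrier S. \<forall>r'\<in>carrier S'.
        (p, r') \<in> R \<and> (q, r') \<in> R \<longrightarrow> (p \<squnion>\<^bsub>S\<^esub> q, r') \<in> R)"

text \<open>
  \<open>Upper S' {}\<close> is all of \<open>carrier S'\<close>, so \<open>\<Squnion>\<^bsub>S'\<^esub>{}\<close> is the minimum of \<open>S'\<close> if there is one;
  otherwise it is an unspecified value, and the guard on \<open>F'\<close> excludes that case.
\<close>

definition decomposition ::
    "('a, 'c) gorder_scheme \<Rightarrow> ('b, 'd) gorder_scheme \<Rightarrow> ('a \<times> 'b) set \<Rightarrow> bool" where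
  "decomposition S S' R \<longleftrightarrow>
     (\<forall>p\<in>carrier S. \<forall>q\<in>carrier S. \<forall>F'. finite F' \<and> F' \<subseteq> carrier S' \<and>
        (F' = {} \<longrightarrow> (\<exists>m. least S' m (carrier S'))) \<and>
        rather_below S p (p \<squnion>\<^bsub>S\<^esub> q) \<and> (p, \<Squnion>\<^bsub>S'\<^esub>F') \<in> R \<longrightarrow>
          (\<exists>F. finite F \<and> F \<subseteq> carrier S \<and> refines R F F' \<and> p \<sqsubseteq>\<^bsub>S\<^esub> join_finite S q F))"

definition complementation ::
    "('a, 'c) gorder_scheme \<Rightarrow> ('b, 'd) gorder_scheme \<Rightarrow> ('a \<times> 'b) set \<Rightarrow> bool" where
  "complementation S S' R \<longleftrightarrow>
     (\<forall>p\<in>carrier S. \<forall>q\<in>carrier S. \<forall>p'\<in>carrier S'. \<forall>q'\<in>carrier S'.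
        rather_below S p (p \<squnion>\<^bsub>S\<^esub> q) \<and> (p, p') \<in> R \<longrightarrow>
          (\<exists>F'. finite F' \<and> F' \<subseteq> carrier S' \<and> (\<forall>f'\<in>F'. q' \<sqsubseteq>\<^bsub>S'\<^esub> p' \<squnion>\<^bsub>S'\<^esub> f') \<and>
             (\<forall>F. finite F \<and> F \<subseteq> carrier S \<and> corefines R F' F \<longrightarrow>
                formal_meet_le S (F \<union> {p}) q)))"

definition vee_relation ::
    "('a, 'c) gorder_scheme \<Rightarrow> ('b, 'd) gorder_scheme \<Rightarrow> ('a \<times> 'b) set \<Rightarrow> bool" where
  "vee_relation S S' R \<longleftrightarrow> R \<subseteq> carrier S \<times> carrier S' \<and>
     auxiliary S S' R \<and> vee_preserving S S' R \<and> decomposition S S' R \<and> complementation S S' R"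

definition order_rel :: "('a, 'b) gorder_scheme \<Rightarrow> ('a \<times> 'a) set" where
  "order_rel S = {(p, q). p \<in> carrier S \<and> q \<in> carrier S \<and> p \<sqsubseteq>\<^bsub>S\<^esub> q}"

text \<open>
  Composition is written in diagrammatic order and does not depend on the objects. Hom-sets are
  indexed by source and target and need not be disjoint.
\<close>

definition is_category ::
    "'o set \<Rightarrow> ('o \<Rightarrow> 'o \<Rightarrow> 'm set) \<Rightarrow> ('o \<Rightarrow> 'm) \<Rightarrow> ('m \<Rightarrow> 'm \<Rightarrow> 'm) \<Rightarrow> bool" where
  "is_category Obj Hom Idn Comp \<longleftrightarrow>
     (\<forall>x\<in>Obj. Idn x \<in> Hom x x) \<and>
     (\<forall>x\<in>Obj. \<forall>y\<in>Obj. \<forall>z\<in>Obj. \<forall>f\<in>Hom x y. \<forall>g\<in>Hom y z. Comp f g \<in> Hom x z) \<and>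
     (\<forall>x\<in>Obj. \<forall>y\<in>Obj. \<forall>f\<in>Hom x y. Comp (Idn x) f = f \<and> Comp f (Idn y) = f) \<and>
     (\<forall>w\<in>Obj. \<forall>x\<in>Obj. \<forall>y\<in>Obj. \<forall>z\<in>Obj. \<forall>f\<in>Hom w x. \<forall>g\<in>Hom x y. \<forall>h\<in>Hom y z.
        Comp (Comp f g) h = Comp f (Comp g h))"

end

theory Submission
  imports Defs
begin

text \<open>
  A pair \<open>a\<close>, \<open>b\<close> with \<open>a \<prec> a \<or> b\<close> plays the role of a compact set \<open>a - b\<close>, and \<open>a \<le> b \<or> p\<close>
  says that \<open>p\<close> covers it. Roundness makes (Decomposition) and (Complementation) available
  relative to such a pair, for every \<open>p\<close> covering it. From this follows that formal meets lift
  along a \<open>\<or>\<close>-relation: if \<open>a - b\<close> is covered by elements related to the members of a finite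
  \<open>X'\<close> with \<open>\<And>X' \<le> g'\<close>, then it is covered by an element related to \<open>g'\<close> (or \<open>a \<le> b\<close>).
  Decomposition of a composite at \<open>p \<sqsubset> p' \<sqsubset>' \<Or>F''\<close> takes some \<open>q' \<succ> p'\<close>, complements \<open>p'\<close> within \<open>q'\<close>
  by (Complementation) of the first relation, and decomposes \<open>p'\<close> relative to each \<open>g'\<close> so obtained.
  Complementation of a composite concludes \<open>a \<le> b \<or> q\<close>; if this fails, subfitness enlarges
  \<open>b \<or> q\<close> to some \<open>b'\<close> with \<open>a \<prec> a \<or> b'\<close> and \<open>a \<nleq> b'\<close>, and lifting meets yields a contradiction.
\<close>

section \<open>Joins, the rather below relation and subfitness in one semilattice\<close>

context upper_semilattice
begin

text \<open>As introduction rules, these make classical proof search on \<open>\<sqsubseteq>\<close> diverge.\<close>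

declare le_cong_l [rule del] le_cong_r [rule del] weak_refl [rule del]
  weak_le_antisym [rule del] le_antisym [rule del]

lemma join_le_iff:
  assumes "x \<in> carrier L" "y \<in> carrier L" "z \<in> carrier L"
  shows "x \<squnion> y \<sqsubseteq> z \<longleftrightarrow> x \<sqsubseteq> z \<and> y \<sqsubseteq> z"
  using assms by (meson join_closed join_le join_left join_right le_trans)

text \<open>Testing against all upper bounds \<open>u\<close> removes the join on the right;
  together with \<open>join_le_iff\<close> this reduces most inequalities between joins to
  first-order reasoning.\<close>

lemma le_join_iff:
  assumes "x \<in> carrier L" "y \<in> carrier L" "z \<in> carrier L"
  shows "x \<sqsubseteq> y \<squnion> z \<longleftrightarrow> (\<forall>u\<in>carrier L. y \<sqsubseteq> u \<longrightarrow> z \<sqsubseteq> u \<longrightarrow> x \<sqsubseteq> u)"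
  using assms by (meson join_closed join_le join_left join_right le_trans)

lemma le_join_le:
  assumes "x \<sqsubseteq> y \<squnion> z" "y \<sqsubseteq> u" "z \<sqsubseteq> u"
    "x \<in> carrier L" "y \<in> carrier L" "z \<in> carrier L" "u \<in> carrier L"
  shows "x \<sqsubseteq> u"
  using assms by (simp add: le_join_iff)

lemma le_join_mono:
  assumes "x \<sqsubseteq> y \<squnion> z" "y \<sqsubseteq> y'" "z \<sqsubseteq> z'"
    "x \<in> carrier L" "y \<in> carrier L" "z \<in> carrier L" "y' \<in> carrier L" "z' \<in> carrier L"
  shows "x \<sqsubseteq> y' \<squnion> z'"
proof (rule le_join_le[OF assms(1)])
  show "y \<sqsubseteq> y' \<squnion> z'"
    by (rule le_trans[OF assms(2) join_left]) (use assms in auto)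
  show "z \<sqsubseteq> y' \<squnion> z'"
    by (rule le_trans[OF assms(3) join_right]) (use assms in auto)
qed (use assms in auto)

lemma le_join_absorb:
  assumes "x \<sqsubseteq> v \<squnion> (b \<squnion> y)" "b \<sqsubseteq> v"
    "x \<in> carrier L" "v \<in> carrier L" "b \<in> carrier L" "y \<in> carrier L"
  shows "x \<sqsubseteq> v \<squnion> y"
proof (rule le_join_le[OF assms(1)])
  show "b \<squnion> y \<sqsubseteq> v \<squnion> y"
    using assms by (intro join_le le_trans[OF assms(2) join_left]) (auto simp: join_right)
qed (use assms join_left in auto)

lemma join_finite_closed [simp]:
  assumes "q \<in> carrier L" "finite F" "F \<subseteq> carrier L"
  shows "join_finite L q F \<in> carrier L"
  using assms by (simp add: join_finite_def)

lemma Sup_le_iff: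
  assumes "finite F" "F \<subseteq> carrier L" "F \<noteq> {}" "u \<in> carrier L"
  shows "\<Squnion>F \<sqsubseteq> u \<longleftrightarrow> (\<forall>f\<in>F. f \<sqsubseteq> u)"
proof -
  have l: "least L (\<Squnion>F) (Upper L F)"
    using finite_sup_least assms by blast
  show ?thesis
  proof
    assume le: "\<Squnion>F \<sqsubseteq> u"
    show "\<forall>f\<in>F. f \<sqsubseteq> u"
    proof
      fix f assume "f \<in> F"
      then have "f \<sqsubseteq> \<Squnion>F" "f \<in> carrier L" "\<Squnion>F \<in> carrier L"
        using assms least_Upper_above[OF l] by auto
      then show "f \<sqsubseteq> u" using le_trans[OF _ le] assms by simp
    qed
  next
    assume "\<forall>f\<in>F. f \<sqsubseteq> u"
    then have "u \<in> Upper L F" using assms by (intro Upper_memI) auto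
    then show "\<Squnion>F \<sqsubseteq> u" using least_le[OF l] by simp
  qed
qed

lemma join_finite_le_iff:
  assumes "q \<in> carrier L" "finite F" "F \<subseteq> carrier L" "u \<in> carrier L"
  shows "join_finite L q F \<sqsubseteq> u \<longleftrightarrow> q \<sqsubseteq> u \<and> (\<forall>f\<in>F. f \<sqsubseteq> u)"
  using assms by (simp add: join_finite_def join_le_iff Sup_le_iff)

text \<open>The same test against upper bounds for \<open>join_finite\<close>. Its form is uniform
  in \<open>F\<close>, so later proofs make no case distinction for an empty decomposition.\<close>

lemma le_join_finite_iff:
  assumes "p \<in> carrier L" "q \<in> carrier L" "finite F" "F \<subseteq> carrier L"
  shows "p \<sqsubseteq> join_finite L q F \<longleftrightarrow>
    (\<forall>u\<in>carrier L. q \<sqsubseteq> u \<longrightarrow> (\<forall>f\<in>F. f \<sqsubseteq> u) \<longrightarrow> p \<sqsubseteq> u)"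
  using assms by (meson join_finite_closed join_finite_le_iff le_refl le_trans)

lemma far_le:
  assumes "far L F" "p \<in> carrier L" "q \<in> carrier L" "\<And>f. f \<in> F \<Longrightarrow> p \<sqsubseteq> q \<squnion> f"
  shows "p \<sqsubseteq> q"
  using assms unfolding far_def by simp

text \<open>The test element in the definition of \<open>p \<prec> q\<close> is \<open>p\<close>
  itself: if \<open>p\<close> were not below \<open>q\<close>, every member of the far set
  \<open>F \<union> {p}\<close> would cover \<open>p\<close> over \<open>q\<close>, which forces
  \<open>p \<sqsubseteq> q\<close>.\<close>

lemma rather_below_le:
  assumes "p \<in> carrier L" "q \<in> carrier L" "rather_below L p q"
  shows "p \<sqsubseteq> q"
proof (rule ccontr)
  assume "\<not> p \<sqsubseteq> q"
  then obtain F where F: "F \<subseteq> carrier L" "far L (F \<union> {p})" "\<forall>f\<in>F. p \<sqsubseteq> f \<squnion> q"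
    using assms unfolding rather_below_def by blast
  have "p \<sqsubseteq> q \<squnion> f" if "f \<in> F \<union> {p}" for f
    using that F(3) assms join_left by (auto simp: join_comm[of L q f])
  then have "p \<sqsubseteq> q" using far_le[OF F(2)] assms by blast
  with \<open>\<not> p \<sqsubseteq> q\<close> show False ..
qed

lemma rather_below_mono:
  assumes "rather_below L p q" "q \<sqsubseteq> q'" "p \<in> carrier L" "q \<in> carrier L" "q' \<in> carrier L"
  shows "rather_below L p q'"
  unfolding rather_below_def
proof (intro ballI impI)
  fix s assume s: "s \<in> carrier L" "\<not> s \<sqsubseteq> q'"
  then have "\<not> s \<sqsubseteq> q" using assms le_trans by meson
  then obtain F where F: "finite F" "F \<subseteq> carrier L" "far L (F \<union> {p})" "\<forall>f\<in>F. s \<sqsubseteq> f \<squnion> q"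
    using assms s unfolding rather_below_def by blast
  have "\<forall>f\<in>F. s \<sqsubseteq> f \<squnion> q'"
    using F(2,4) assms s by (meson le_join_mono le_refl subsetD)
  with F show "\<exists>F. finite F \<and> F \<subseteq> carrier L \<and> far L (F \<union> {p}) \<and> (\<forall>f\<in>F. s \<sqsubseteq> f \<squnion> q')"
    by blast
qed

text \<open>\<open>Q\<close> is a finite complement of the cover \<open>p\<close> inside
  \<open>r\<close>, over the base \<open>b\<close>. It comes from the definition of
  \<open>a \<prec> a \<or> b\<close> with test element \<open>r\<close>: the far set
  \<open>F \<union> {a}\<close> puts the formal meet of \<open>Q \<union> {a}\<close> below every
  \<open>v\<close> above \<open>b\<close>.\<close>

lemma complement_cover:
  assumes car: "a \<in> carrier L" "b \<in> carrier L" "p \<in> carrier L" "r \<in> carrier L"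
    and ab: "rather_below L a (a \<squnion> b)" and le: "a \<sqsubseteq> b \<squnion> p"
  obtains Q where "finite Q" "Q \<subseteq> carrier L" "\<And>q. q \<in> Q \<Longrightarrow> r \<sqsubseteq> p \<squnion> q"
    "\<And>c v. \<lbrakk>c \<in> carrier L; v \<in> carrier L; b \<sqsubseteq> v; c \<sqsubseteq> v \<squnion> a; \<And>q. q \<in> Q \<Longrightarrow> c \<sqsubseteq> v \<squnion> q\<rbrakk>
      \<Longrightarrow> c \<sqsubseteq> v"
proof (cases "r \<sqsubseteq> a \<squnion> b")
  case True
  \<comment> \<open>The definition gives no witness for such an \<open>r\<close>, but then
    \<open>{b}\<close> serves as complement, because \<open>b\<close> is absorbed by every
    \<open>v\<close> above it.\<close>
  have "r \<sqsubseteq> p \<squnion> b"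
    using True le car by (simp add: le_join_iff)
  moreover have "c \<sqsubseteq> v" if "c \<in> carrier L" "v \<in> carrier L" "b \<sqsubseteq> v" "c \<sqsubseteq> v \<squnion> b" for c v
    using that car by (simp add: le_join_iff)
  ultimately show thesis using car by (intro that[of "{b}"]) auto
next
  case False
  then obtain F where F: "finite F" "F \<subseteq> carrier L" "far L (F \<union> {a})" "\<forall>f\<in>F. r \<sqsubseteq> f \<squnion> (a \<squnion> b)"
    using ab car(4) unfolding rather_below_def by blast
  \<comment> \<open>Replacing \<open>a\<close> by its cover \<open>b \<squnion> p\<close> turns
    \<open>r \<sqsubseteq> f \<squnion> (a \<squnion> b)\<close> into
    \<open>r \<sqsubseteq> p \<squnion> (b \<squnion> f)\<close>; the added \<open>b\<close> is
    absorbed again by \<open>v\<close>.\<close>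
  show thesis
  proof (rule that[of "(\<lambda>f. b \<squnion> f) ` F"])
    fix q assume "q \<in> (\<lambda>f. b \<squnion> f) ` F"
    then obtain f where f: "f \<in> F" "q = b \<squnion> f" by blast
    then have fc: "f \<in> carrier L" using F by blast
    have "r \<sqsubseteq> f \<squnion> (a \<squnion> b)" using F f by blast
    then show "r \<sqsubseteq> p \<squnion> q"
      using f(2) fc le car by (simp add: le_join_iff join_le_iff)
  next
    fix c v assume v: "c \<in> carrier L" "v \<in> carrier L" "b \<sqsubseteq> v" "c \<sqsubseteq> v \<squnion> a"
      and q: "\<And>q. q \<in> (\<lambda>f. b \<squnion> f) ` F \<Longrightarrow> c \<sqsubseteq> v \<squnion> q"
    have "c \<sqsubseteq> v \<squnion> f" if "f \<in> F" for f
    proof -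
      have "c \<sqsubseteq> v \<squnion> (b \<squnion> f)" using q that by blast
      moreover have "f \<in> carrier L" using that F by blast
      ultimately show ?thesis using v car le_join_absorb by blast
    qed
    then show "c \<sqsubseteq> v" using v by (rule_tac far_le[OF F(3)]) auto
  qed (use F car in auto)
qed

text \<open>With \<open>p \<prec> r\<close> from roundness, each \<open>q\<close> in the complement
  of \<open>p\<close> inside \<open>r\<close> satisfies
  \<open>r \<sqsubseteq> p \<squnion> q\<close>, hence \<open>p \<prec> p \<or> q\<close>. So the
  axioms apply to \<open>p\<close> over each \<open>q\<close>, and the last property glues the
  finitely many results into one about \<open>a\<close> over \<open>b\<close>.\<close>

lemma localization:
  assumes round: "round_semilattice L"
    and car: "a \<in> carrier L" "b \<in> carrier L" "p \<in> carrier L"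
    and ab: "rather_below L a (a \<squnion> b)" and le: "a \<sqsubseteq> b \<squnion> p"
  obtains Q where "finite Q" "Q \<subseteq> carrier L" "\<And>q. q \<in> Q \<Longrightarrow> rather_below L p (p \<squnion> q)"
    "\<And>v. \<lbrakk>v \<in> carrier L; b \<sqsubseteq> v; \<And>q. q \<in> Q \<Longrightarrow> a \<sqsubseteq> v \<squnion> q\<rbrakk> \<Longrightarrow> a \<sqsubseteq> v"
proof -
  obtain r where r: "r \<in> carrier L" "rather_below L p r"
    using round car unfolding round_semilattice_def by blast
  from complement_cover[OF car r(1) ab le]
  obtain Q where Q: "finite Q" "Q \<subseteq> carrier L" "\<And>q. q \<in> Q \<Longrightarrow> r \<sqsubseteq> p \<squnion> q"
    "\<And>c v. \<lbrakk>c \<in> carrier L; v \<in> carrier L; b \<sqsubseteq> v; c \<sqsubseteq> v \<squnion> a; \<And>q. q \<in> Q \<Longrightarrow> c \<sqsubseteq> v \<squnion> q\<rbrakk>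
      \<Longrightarrow> c \<sqsubseteq> v"
    by blast
  show thesis
  proof (rule that[OF Q(1,2)])
    fix q assume "q \<in> Q"
    then have "q \<in> carrier L" "r \<sqsubseteq> p \<squnion> q" using Q by auto
    then show "rather_below L p (p \<squnion> q)" using rather_below_mono[OF r(2)] car r(1) by simp
  next
    fix v assume "v \<in> carrier L" "b \<sqsubseteq> v" "\<And>q. q \<in> Q \<Longrightarrow> a \<sqsubseteq> v \<squnion> q"
    then show "a \<sqsubseteq> v" using Q(4)[of a v] car join_right by simp
  qed
qed

text \<open>Subfitness is applied to an upper bound \<open>r\<close> of \<open>a\<close> with
  \<open>a \<prec> r\<close>. The resulting \<open>b'\<close> has
  \<open>r \<sqsubseteq> a \<squnion> b'\<close>, so \<open>a \<prec> a \<or> b'\<close> by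
  monotonicity, and \<open>a \<sqsubseteq> b'\<close> would entail
  \<open>r \<sqsubseteq> b'\<close>.\<close>

lemma subfit_witness:
  assumes "subfit L" "round_semilattice L" "a \<in> carrier L" "b \<in> carrier L" "\<not> a \<sqsubseteq> b"
  obtains b' where "b' \<in> carrier L" "b \<sqsubseteq> b'" "rather_below L a (a \<squnion> b')" "\<not> a \<sqsubseteq> b'"
proof -
  obtain r where r: "r \<in> carrier L" "rather_below L a r"
    using assms unfolding round_semilattice_def by blast
  have "a \<sqsubseteq> r" using rather_below_le r assms by simp
  then obtain b' where b': "b' \<in> carrier L" "b \<sqsubseteq> b'" "r \<sqsubseteq> a \<squnion> b'" "\<not> r \<sqsubseteq> b'"
    using assms r unfolding subfit_def by meson
  have "\<not> a \<sqsubseteq> b'"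
    using b' r assms by (metis join_closed join_le le_refl le_trans)
  moreover have "rather_below L a (a \<squnion> b')"
    using rather_below_mono r b' assms by auto
  ultimately show thesis using b' that by blast
qed

end

section \<open>One \<or>-relation: axioms relative to a covered pair, and lifting of formal
  meets\<close>

lemma formal_meet_leD:
  assumes "formal_meet_le S E q" "a \<in> carrier S" "b \<in> carrier S"
    "\<And>e. e \<in> E \<Longrightarrow> a \<sqsubseteq>\<^bsub>S\<^esub> b \<squnion>\<^bsub>S\<^esub> e"
  shows "a \<sqsubseteq>\<^bsub>S\<^esub> b \<squnion>\<^bsub>S\<^esub> q"
  using assms unfolding formal_meet_le_def by blast

locale vee_morphism =
  S: upper_semilattice S + S': upper_semilattice S'
  for S :: "('a, 'c) gorder_scheme" and S' :: "('b, 'd) gorder_scheme" +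
  fixes R :: "('a \<times> 'b) set"
  assumes subfit_round: "subfit_round_semilattice S" "subfit_round_semilattice S'"
    and vee_relation: "vee_relation S S' R"
begin

lemma round: "round_semilattice S" "round_semilattice S'"
  using subfit_round unfolding subfit_round_semilattice_def by auto

lemma carriers: "(p, p') \<in> R \<Longrightarrow> p \<in> carrier S" "(p, p') \<in> R \<Longrightarrow> p' \<in> carrier S'"
  using vee_relation unfolding vee_relation_def by auto

lemma auxiliaryD:
  assumes "p \<in> carrier S" "p \<sqsubseteq>\<^bsub>S\<^esub> q" "(q, q') \<in> R" "q' \<sqsubseteq>\<^bsub>S'\<^esub> p'" "p' \<in> carrier S'"
  shows "(p, p') \<in> R"
  using vee_relation assms carriers[OF assms(3)]
  unfolding vee_relation_def auxiliary_def by blast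

lemma preservingD:
  assumes "(p, r') \<in> R" "(q, r') \<in> R"
  shows "(p \<squnion>\<^bsub>S\<^esub> q, r') \<in> R"
  using vee_relation assms carriers[OF assms(1)] carriers[OF assms(2)]
  unfolding vee_relation_def vee_preserving_def by blast

lemma decompositionD:
  assumes "p \<in> carrier S" "q \<in> carrier S" "rather_below S p (p \<squnion>\<^bsub>S\<^esub> q)"
    "finite F'" "F' \<subseteq> carrier S'" "F' = {} \<Longrightarrow> \<exists>m. least S' m (carrier S')"
    "(p, \<Squnion>\<^bsub>S'\<^esub>F') \<in> R"
  obtains F where "finite F" "F \<subseteq> carrier S" "refines R F F'" "p \<sqsubseteq>\<^bsub>S\<^esub> join_finite S q F"
  using vee_relation assms unfolding vee_relation_def decomposition_def by meson

lemma complementationD: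
  assumes "rather_below S p (p \<squnion>\<^bsub>S\<^esub> q)" "(p, p') \<in> R" "q \<in> carrier S" "q' \<in> carrier S'"
  obtains F' where "finite F'" "F' \<subseteq> carrier S'"
    "\<And>f'. f' \<in> F' \<Longrightarrow> q' \<sqsubseteq>\<^bsub>S'\<^esub> p' \<squnion>\<^bsub>S'\<^esub> f'"
    "\<And>F. \<lbrakk>finite F; F \<subseteq> carrier S; corefines R F' F\<rbrakk> \<Longrightarrow> formal_meet_le S (F \<union> {p}) q"
proof -
  from vee_relation have "complementation S S' R" unfolding vee_relation_def by blast
  from this[unfolded complementation_def, THEN bspec, THEN bspec, THEN bspec, THEN bspec,
      OF carriers(1)[OF assms(2)] assms(3) carriers(2)[OF assms(2)] assms(4),
      THEN mp, OF conjI[OF assms(1,2)]]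
  obtain F' where F': "finite F' \<and> F' \<subseteq> carrier S' \<and>
    (\<forall>f'\<in>F'. q' \<sqsubseteq>\<^bsub>S'\<^esub> p' \<squnion>\<^bsub>S'\<^esub> f') \<and>
    (\<forall>F. finite F \<and> F \<subseteq> carrier S \<and> corefines R F' F \<longrightarrow> formal_meet_le S (F \<union> {p}) q)" ..
  show thesis by (rule that[of F']) (use F' in auto)
qed

text \<open>Decomposing \<open>p\<close> over each \<open>q\<close> supplied by
  \<open>localization\<close> gives finite sets \<open>G q\<close>, whose union decomposes
  \<open>a\<close> over \<open>b\<close>. This transfers (Decomposition) from \<open>p\<close> to
  any pair that \<open>p\<close> covers.\<close>

lemma relative_decomposition:
  assumes car: "a \<in> carrier S" "b \<in> carrier S" "p \<in> carrier S"
    and ab: "rather_below S a (a \<squnion>\<^bsub>S\<^esub> b)" and le: "a \<sqsubseteq>\<^bsub>S\<^esub> b \<squnion>\<^bsub>S\<^esub> p"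
    and F': "finite F'" "F' \<subseteq> carrier S'" "F' \<noteq> {}"
    and R: "(p, \<Squnion>\<^bsub>S'\<^esub>F') \<in> R"
  obtains F where "finite F" "F \<subseteq> carrier S" "refines R F F'" "a \<sqsubseteq>\<^bsub>S\<^esub> join_finite S b F"
proof -
  obtain Q where Q: "finite Q" "Q \<subseteq> carrier S"
      "\<And>q. q \<in> Q \<Longrightarrow> rather_below S p (p \<squnion>\<^bsub>S\<^esub> q)"
      "\<And>v. \<lbrakk>v \<in> carrier S; b \<sqsubseteq>\<^bsub>S\<^esub> v; \<And>q. q \<in> Q \<Longrightarrow> a \<sqsubseteq>\<^bsub>S\<^esub> v \<squnion>\<^bsub>S\<^esub> q\<rbrakk> \<Longrightarrow> a \<sqsubseteq>\<^bsub>S\<^esub> v"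
    using S.localization[OF round(1) car ab le] by blast
  have "\<exists>F. finite F \<and> F \<subseteq> carrier S \<and> refines R F F' \<and> p \<sqsubseteq>\<^bsub>S\<^esub> join_finite S q F"
    if q: "q \<in> Q" for q
  proof -
    have "q \<in> carrier S" using q Q(2) by blast
    then obtain F where "finite F" "F \<subseteq> carrier S" "refines R F F'" "p \<sqsubseteq>\<^bsub>S\<^esub> join_finite S q F"
      using decompositionD[OF car(3) _ Q(3)[OF q] F'(1,2) _ R] F'(3) by metis
    then show ?thesis by blast
  qed
  then obtain G where G: "\<And>q. q \<in> Q \<Longrightarrow> finite (G q)" "\<And>q. q \<in> Q \<Longrightarrow> G q \<subseteq> carrier S"
      "\<And>q. q \<in> Q \<Longrightarrow> refines R (G q) F'" "\<And>q. q \<in> Q \<Longrightarrow> p \<sqsubseteq>\<^bsub>S\<^esub> join_finite S q (G q)"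
    by metis
  let ?F = "\<Union>q\<in>Q. G q"
  have F: "finite ?F" "?F \<subseteq> carrier S" using G Q by auto
  have "a \<sqsubseteq>\<^bsub>S\<^esub> u" if u: "u \<in> carrier S" "b \<sqsubseteq>\<^bsub>S\<^esub> u" "\<forall>f\<in>?F. f \<sqsubseteq>\<^bsub>S\<^esub> u" for u
  proof (rule Q(4)[OF u(1,2)])
    fix q assume q: "q \<in> Q"
    then have qc: "q \<in> carrier S" using Q by blast
    have "p \<sqsubseteq>\<^bsub>S\<^esub> w" if "w \<in> carrier S" "u \<sqsubseteq>\<^bsub>S\<^esub> w" "q \<sqsubseteq>\<^bsub>S\<^esub> w" for w
    proof -
      have "\<forall>f\<in>G q. f \<sqsubseteq>\<^bsub>S\<^esub> w"
        using u q G(2)[OF q] that by (meson S.le_trans UN_I subsetD)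
      then show ?thesis
        using G(4)[OF q] that car qc G(1,2)[OF q] by (simp add: S.le_join_finite_iff)
    qed
    then show "a \<sqsubseteq>\<^bsub>S\<^esub> u \<squnion>\<^bsub>S\<^esub> q"
      using car qc u S.join_closed by (rule_tac S.le_join_le[OF le])
        (auto simp: S.le_join_iff intro: S.le_trans)
  qed
  then have "a \<sqsubseteq>\<^bsub>S\<^esub> join_finite S b ?F"
    using F car by (simp add: S.le_join_finite_iff)
  moreover have "refines R ?F F'" using G(3) unfolding refines_def by blast
  ultimately show thesis using F that by blast
qed

text \<open>The sets given by (Complementation) for \<open>p\<close> over the localizing elements
  are united. The quantifier over finite \<open>F\<close> turns into a condition on each
  \<open>f'\<close> separately: some element related to \<open>f'\<close> covers \<open>a\<close>
  over \<open>v\<close>.\<close>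

lemma relative_complementation:
  assumes car: "a \<in> carrier S" "b \<in> carrier S" "q' \<in> carrier S'"
    and ab: "rather_below S a (a \<squnion>\<^bsub>S\<^esub> b)" and le: "a \<sqsubseteq>\<^bsub>S\<^esub> b \<squnion>\<^bsub>S\<^esub> p"
    and R: "(p, p') \<in> R"
  obtains F' where "finite F'" "F' \<subseteq> carrier S'"
    "\<And>f'. f' \<in> F' \<Longrightarrow> q' \<sqsubseteq>\<^bsub>S'\<^esub> p' \<squnion>\<^bsub>S'\<^esub> f'"
    "\<And>v. \<lbrakk>v \<in> carrier S; b \<sqsubseteq>\<^bsub>S\<^esub> v; \<And>f'. f' \<in> F' \<Longrightarrow> \<exists>f. (f, f') \<in> R \<and> a \<sqsubseteq>\<^bsub>S\<^esub> v \<squnion>\<^bsub>S\<^esub> f\<rbrakk>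
      \<Longrightarrow> a \<sqsubseteq>\<^bsub>S\<^esub> v"
proof -
  have p: "p \<in> carrier S" "p' \<in> carrier S'" using R carriers by auto
  obtain Q where Q: "finite Q" "Q \<subseteq> carrier S"
      "\<And>q. q \<in> Q \<Longrightarrow> rather_below S p (p \<squnion>\<^bsub>S\<^esub> q)"
      "\<And>v. \<lbrakk>v \<in> carrier S; b \<sqsubseteq>\<^bsub>S\<^esub> v; \<And>q. q \<in> Q \<Longrightarrow> a \<sqsubseteq>\<^bsub>S\<^esub> v \<squnion>\<^bsub>S\<^esub> q\<rbrakk> \<Longrightarrow> a \<sqsubseteq>\<^bsub>S\<^esub> v"
    using S.localization[OF round(1) car(1,2) p(1) ab le] by blast
  have "\<exists>G'. finite G' \<and> G' \<subseteq> carrier S' \<and> (\<forall>f'\<in>G'. q' \<sqsubseteq>\<^bsub>S'\<^esub> p' \<squnion>\<^bsub>S'\<^esub> f') \<and>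
      (\<forall>F. finite F \<longrightarrow> F \<subseteq> carrier S \<longrightarrow> corefines R G' F \<longrightarrow> formal_meet_le S (F \<union> {p}) q)"
    if q: "q \<in> Q" for q
  proof -
    have "q \<in> carrier S" using q Q(2) by blast
    from complementationD[OF Q(3)[OF q] R this car(3)]
    obtain G' where "finite G'" "G' \<subseteq> carrier S'" "\<And>f'. f' \<in> G' \<Longrightarrow> q' \<sqsubseteq>\<^bsub>S'\<^esub> p' \<squnion>\<^bsub>S'\<^esub> f'"
      "\<And>F. \<lbrakk>finite F; F \<subseteq> carrier S; corefines R G' F\<rbrakk> \<Longrightarrow> formal_meet_le S (F \<union> {p}) q"
      by metis
    then show ?thesis by metis
  qed
  then obtain G' where G': "\<And>q. q \<in> Q \<Longrightarrow> finite (G' q)" "\<And>q. q \<in> Q \<Longrightarrow> G' q \<subseteq> carrier S'"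
      "\<And>q f'. q \<in> Q \<Longrightarrow> f' \<in> G' q \<Longrightarrow> q' \<sqsubseteq>\<^bsub>S'\<^esub> p' \<squnion>\<^bsub>S'\<^esub> f'"
      "\<And>q F. q \<in> Q \<Longrightarrow> finite F \<Longrightarrow> F \<subseteq> carrier S \<Longrightarrow> corefines R (G' q) F
        \<Longrightarrow> formal_meet_le S (F \<union> {p}) q"
    by metis
  show thesis
  proof (rule that[of "\<Union>q\<in>Q. G' q"])
    fix v assume v: "v \<in> carrier S" "b \<sqsubseteq>\<^bsub>S\<^esub> v"
      and ex: "\<And>f'. f' \<in> (\<Union>q\<in>Q. G' q) \<Longrightarrow> \<exists>f. (f, f') \<in> R \<and> a \<sqsubseteq>\<^bsub>S\<^esub> v \<squnion>\<^bsub>S\<^esub> f"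
    \<comment> \<open>The choice \<open>h f'\<close> depends on \<open>f'\<close> alone, so the
      image of \<open>G' q\<close> under \<open>h\<close> is a finite set that \<open>G' q\<close>
      corefines, and (Complementation) applies to it.\<close>
    obtain h where h: "\<And>q f'. q \<in> Q \<Longrightarrow> f' \<in> G' q \<Longrightarrow> (h f', f') \<in> R"
        "\<And>q f'. q \<in> Q \<Longrightarrow> f' \<in> G' q \<Longrightarrow> a \<sqsubseteq>\<^bsub>S\<^esub> v \<squnion>\<^bsub>S\<^esub> h f'"
      using ex by (metis UN_I)
    have "a \<sqsubseteq>\<^bsub>S\<^esub> v \<squnion>\<^bsub>S\<^esub> p"
      using v car p by (rule_tac S.le_join_mono[OF le]) auto
    show "a \<sqsubseteq>\<^bsub>S\<^esub> v"
    proof (rule Q(4)[OF v])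
      fix q assume q: "q \<in> Q"
      show "a \<sqsubseteq>\<^bsub>S\<^esub> v \<squnion>\<^bsub>S\<^esub> q"
      proof (rule formal_meet_leD[OF G'(4)[OF q, of "h ` G' q"] car(1) v(1)])
        show "h ` G' q \<subseteq> carrier S" using h q carriers by blast
        show "corefines R (G' q) (h ` G' q)" using h q unfolding corefines_def by blast
      qed (use G' h q \<open>a \<sqsubseteq>\<^bsub>S\<^esub> v \<squnion>\<^bsub>S\<^esub> p\<close> in auto)
    qed
  next
    show "(\<Union>q\<in>Q. G' q) \<subseteq> carrier S'" using G'(2) by blast
  qed (use Q(1) G'(1,3) in auto)
qed

text \<open>The base point \<open>b\<close> belongs to this set because no element at all need be related to \<open>x'\<close>.\<close>

definition joins_below :: "'a \<Rightarrow> 'b \<Rightarrow> 'a set" where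
  "joins_below b x' = insert b {b \<squnion>\<^bsub>S\<^esub> c | c. (c, x') \<in> R}"

lemma joins_below_closed:
  assumes "b \<in> carrier S" "v \<in> joins_below b x'"
  shows "v \<in> carrier S" "b \<sqsubseteq>\<^bsub>S\<^esub> v"
  using assms carriers S.join_left unfolding joins_below_def by auto

text \<open>Directedness comes from (\<or>-Preserving): \<open>b \<squnion> c\<close> and
  \<open>b \<squnion> d\<close> lie below \<open>b \<squnion> (c \<squnion> d)\<close>, while
  \<open>b\<close> lies below every member. The base point also answers the case of an empty
  \<open>A\<close>.\<close>

lemma joins_below_directed:
  assumes b: "b \<in> carrier S" and "finite A"
    and "\<And>a. a \<in> A \<Longrightarrow> a \<in> carrier S \<and> (\<exists>v\<in>joins_below b x'. a \<sqsubseteq>\<^bsub>S\<^esub> v)"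
  shows "\<exists>v\<in>joins_below b x'. \<forall>a\<in>A. a \<sqsubseteq>\<^bsub>S\<^esub> v"
  using assms(2,3)
proof (induction A)
  case empty
  then show ?case unfolding joins_below_def by blast
next
  case (insert a A)
  then obtain v where v: "v \<in> joins_below b x'" "\<forall>a\<in>A. a \<sqsubseteq>\<^bsub>S\<^esub> v" by blast
  obtain w where w: "w \<in> joins_below b x'" "a \<sqsubseteq>\<^bsub>S\<^esub> w" using insert by blast
  have vw: "v \<in> carrier S" "w \<in> carrier S" "b \<sqsubseteq>\<^bsub>S\<^esub> v" "b \<sqsubseteq>\<^bsub>S\<^esub> w"
    using v w joins_below_closed b by auto
  have "\<exists>z\<in>joins_below b x'. v \<sqsubseteq>\<^bsub>S\<^esub> z \<and> w \<sqsubseteq>\<^bsub>S\<^esub> z"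
  proof (cases "v = b \<or> w = b")
    case True
    then show ?thesis using v w vw by (metis S.le_refl)
  next
    case False
    then obtain c d where cd: "v = b \<squnion>\<^bsub>S\<^esub> c" "(c, x') \<in> R" "w = b \<squnion>\<^bsub>S\<^esub> d" "(d, x') \<in> R"
      using v w unfolding joins_below_def by blast
    have "c \<in> carrier S" "d \<in> carrier S" using cd carriers by auto
    then have "v \<sqsubseteq>\<^bsub>S\<^esub> b \<squnion>\<^bsub>S\<^esub> (c \<squnion>\<^bsub>S\<^esub> d)" "w \<sqsubseteq>\<^bsub>S\<^esub> b \<squnion>\<^bsub>S\<^esub> (c \<squnion>\<^bsub>S\<^esub> d)"
      using b cd by (auto simp: S.le_join_iff S.join_le_iff)
    moreover have "b \<squnion>\<^bsub>S\<^esub> (c \<squnion>\<^bsub>S\<^esub> d) \<in> joins_below b x'"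
      using cd preservingD unfolding joins_below_def by blast
    ultimately show ?thesis by blast
  qed
  then obtain z where z: "z \<in> joins_below b x'" "v \<sqsubseteq>\<^bsub>S\<^esub> z" "w \<sqsubseteq>\<^bsub>S\<^esub> z" by blast
  have "z \<in> carrier S" using z joins_below_closed b by blast
  then have "\<forall>x\<in>insert a A. x \<sqsubseteq>\<^bsub>S\<^esub> z"
    using v w vw z insert.prems by (metis S.le_trans insert_iff)
  with z show ?case by blast
qed

lemma joins_below_bound:
  assumes b: "b \<in> carrier S" and "finite F"
  shows "\<exists>v\<in>joins_below b x'. \<forall>f\<in>F. (f, x') \<in> R \<longrightarrow> f \<sqsubseteq>\<^bsub>S\<^esub> v"
proof -
  let ?A = "{f \<in> F. (f, x') \<in> R}"
  have "finite ?A" using assms by simp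
  moreover have "a \<in> carrier S \<and> (\<exists>v\<in>joins_below b x'. a \<sqsubseteq>\<^bsub>S\<^esub> v)" if "a \<in> ?A" for a
    using that b carriers S.join_right unfolding joins_below_def by blast
  ultimately have "\<exists>v\<in>joins_below b x'. \<forall>a\<in>?A. a \<sqsubseteq>\<^bsub>S\<^esub> v"
    by (rule joins_below_directed[OF b])
  then show ?thesis by blast
qed

text \<open>In a decomposition along \<open>{x', y'}\<close> every part is related to
  \<open>x'\<close> or to \<open>y'\<close>; by directedness each of the two groups has a single
  bound.\<close>

lemma relative_binary_decomposition:
  assumes car: "a \<in> carrier S" "b \<in> carrier S" "x' \<in> carrier S'" "y' \<in> carrier S'"
    and ab: "rather_below S a (a \<squnion>\<^bsub>S\<^esub> b)" and le: "a \<sqsubseteq>\<^bsub>S\<^esub> b \<squnion>\<^bsub>S\<^esub> p"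
    and R: "(p, x' \<squnion>\<^bsub>S'\<^esub> y') \<in> R"
  obtains v w where "v \<in> joins_below b x'" "w \<in> joins_below b y'" "a \<sqsubseteq>\<^bsub>S\<^esub> v \<squnion>\<^bsub>S\<^esub> w"
proof -
  obtain F where F: "finite F" "F \<subseteq> carrier S" "refines R F {x', y'}" "a \<sqsubseteq>\<^bsub>S\<^esub> join_finite S b F"
    using relative_decomposition[OF car(1,2) carriers(1)[OF R] ab le, of "{x', y'}"] car R
    unfolding join_def by blast
  obtain v where v: "v \<in> joins_below b x'" "\<And>f. f \<in> F \<Longrightarrow> (f, x') \<in> R \<Longrightarrow> f \<sqsubseteq>\<^bsub>S\<^esub> v"
    using joins_below_bound[OF car(2) F(1), of x'] by metis
  obtain w where w: "w \<in> joins_below b y'" "\<And>f. f \<in> F \<Longrightarrow> (f, y') \<in> R \<Longrightarrow> f \<sqsubseteq>\<^bsub>S\<^esub> w"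
    using joins_below_bound[OF car(2) F(1), of y'] by metis
  have vw: "v \<in> carrier S" "w \<in> carrier S" "b \<sqsubseteq>\<^bsub>S\<^esub> v" "b \<sqsubseteq>\<^bsub>S\<^esub> w"
    using v w joins_below_closed car by auto
  have "f \<sqsubseteq>\<^bsub>S\<^esub> v \<squnion>\<^bsub>S\<^esub> w" if "f \<in> F" for f
  proof -
    have "f \<sqsubseteq>\<^bsub>S\<^esub> v \<or> f \<sqsubseteq>\<^bsub>S\<^esub> w" using that F v w unfolding refines_def by blast
    moreover have "f \<in> carrier S" using that F by blast
    ultimately show ?thesis using vw(1,2) by (auto simp: S.le_join_iff intro: S.le_trans)
  qed
  moreover have "b \<sqsubseteq>\<^bsub>S\<^esub> v \<squnion>\<^bsub>S\<^esub> w"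
    using vw car by (auto simp: S.le_join_iff intro: S.le_trans)
  ultimately have "a \<sqsubseteq>\<^bsub>S\<^esub> v \<squnion>\<^bsub>S\<^esub> w"
    using F vw car by (simp add: S.le_join_finite_iff)
  with v w show thesis using that by blast
qed

text \<open>Induction on \<open>X'\<close>. To remove \<open>x'\<close>, it is complemented inside
  another member \<open>y'\<close> by a finite set \<open>H'\<close>. For each \<open>h'\<close> in
  \<open>H'\<close> the remaining meet is below \<open>g' \<squnion> h'\<close>, so the induction
  hypothesis and binary decomposition cover \<open>a\<close> by a part for \<open>g'\<close> and a
  part for \<open>h'\<close>. The parts for \<open>g'\<close> have a common bound \<open>z\<close>,
  and relative complementation removes the parts for \<open>h'\<close>.\<close>

lemma formal_meet_lift:
  assumes "finite X'" "X' \<noteq> {}"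
    and car: "a \<in> carrier S" "b \<in> carrier S"
    and ab: "rather_below S a (a \<squnion>\<^bsub>S\<^esub> b)"
    and "\<And>x'. x' \<in> X' \<Longrightarrow> \<exists>f. (f, x') \<in> R \<and> a \<sqsubseteq>\<^bsub>S\<^esub> b \<squnion>\<^bsub>S\<^esub> f"
    and "g' \<in> carrier S'" "formal_meet_le S' X' g'"
  shows "\<exists>v\<in>joins_below b g'. a \<sqsubseteq>\<^bsub>S\<^esub> v"
  using assms(1,2,6-)
proof (induction X' arbitrary: g' rule: finite_ne_induct)
  case (singleton x')
  then obtain f where f: "(f, x') \<in> R" "a \<sqsubseteq>\<^bsub>S\<^esub> b \<squnion>\<^bsub>S\<^esub> f" by blast
  then have fc: "f \<in> carrier S" "x' \<in> carrier S'" using carriers by auto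
  have "x' \<sqsubseteq>\<^bsub>S'\<^esub> g' \<squnion>\<^bsub>S'\<^esub> g'"
    using singleton fc by (rule_tac formal_meet_leD[of S' "{x'}"]) (auto simp: S'.join_right)
  then have "x' \<sqsubseteq>\<^bsub>S'\<^esub> g'" using singleton fc by (simp add: S'.le_join_iff)
  then have "(f, g') \<in> R" using auxiliaryD f fc singleton by blast
  then show ?case using f unfolding joins_below_def by blast
next
  case (insert x' X')
  obtain f where f: "(f, x') \<in> R" "a \<sqsubseteq>\<^bsub>S\<^esub> b \<squnion>\<^bsub>S\<^esub> f" using insert.prems(1) by blast
  have "y' \<in> carrier S'" if "y' \<in> insert x' X'" for y'
    using insert.prems(1)[OF that] carriers(2) by blast
  then have x': "x' \<in> carrier S'" "X' \<subseteq> carrier S'" by auto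
  then obtain y' where y': "y' \<in> X'" "y' \<in> carrier S'" using insert.hyps by blast
  obtain H' where H': "finite H'" "H' \<subseteq> carrier S'"
      "\<And>h'. h' \<in> H' \<Longrightarrow> y' \<sqsubseteq>\<^bsub>S'\<^esub> x' \<squnion>\<^bsub>S'\<^esub> h'"
      "\<And>v. \<lbrakk>v \<in> carrier S; b \<sqsubseteq>\<^bsub>S\<^esub> v; \<And>h'. h' \<in> H' \<Longrightarrow> \<exists>f. (f, h') \<in> R \<and> a \<sqsubseteq>\<^bsub>S\<^esub> v \<squnion>\<^bsub>S\<^esub> f\<rbrakk>
        \<Longrightarrow> a \<sqsubseteq>\<^bsub>S\<^esub> v"
    using relative_complementation[OF car y'(2) ab f(2,1)] by blast
  have "\<exists>v\<in>joins_below b g'. \<exists>w\<in>joins_below b h'. a \<sqsubseteq>\<^bsub>S\<^esub> v \<squnion>\<^bsub>S\<^esub> w" if "h' \<in> H'" for h'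
  proof -
    have h': "h' \<in> carrier S'" "y' \<sqsubseteq>\<^bsub>S'\<^esub> x' \<squnion>\<^bsub>S'\<^esub> h'" using that H' by auto
    have "formal_meet_le S' X' (g' \<squnion>\<^bsub>S'\<^esub> h')"
      unfolding formal_meet_le_def
    proof (intro ballI impI)
      fix c d assume cd: "c \<in> carrier S'" "d \<in> carrier S'" "\<forall>e\<in>X'. c \<sqsubseteq>\<^bsub>S'\<^esub> d \<squnion>\<^bsub>S'\<^esub> e"
      \<comment> \<open>The original formal inequality is tested over the base
        \<open>d \<squnion> h'\<close>. There \<open>x'\<close> covers \<open>c\<close>, because
        \<open>y'\<close> covers it over \<open>d\<close> and
        \<open>y' \<sqsubseteq> x' \<squnion> h'\<close>.\<close>
      have "c \<sqsubseteq>\<^bsub>S'\<^esub> (d \<squnion>\<^bsub>S'\<^esub> h') \<squnion>\<^bsub>S'\<^esub> g'"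
      proof (rule formal_meet_leD[OF insert.prems(3)])
        fix e assume "e \<in> insert x' X'"
        then consider "e = x'" | "e \<in> X'" by blast
        then show "c \<sqsubseteq>\<^bsub>S'\<^esub> (d \<squnion>\<^bsub>S'\<^esub> h') \<squnion>\<^bsub>S'\<^esub> e"
        proof cases
          case 1
          have "c \<sqsubseteq>\<^bsub>S'\<^esub> d \<squnion>\<^bsub>S'\<^esub> y'" using cd y' by blast
          then show ?thesis
            using 1 h' cd(1,2) y' x' by (simp add: S'.le_join_iff S'.join_le_iff)
        next
          case 2
          then have "c \<sqsubseteq>\<^bsub>S'\<^esub> d \<squnion>\<^bsub>S'\<^esub> e" "e \<in> carrier S'" using cd x' by auto
          then show ?thesis
            using h' cd(1,2) by (simp add: S'.le_join_iff S'.join_le_iff)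
        qed
      qed (use cd h' in auto)
      then show "c \<sqsubseteq>\<^bsub>S'\<^esub> d \<squnion>\<^bsub>S'\<^esub> (g' \<squnion>\<^bsub>S'\<^esub> h')"
        using cd(1,2) h' insert.prems(2) by (simp add: S'.le_join_iff S'.join_le_iff)
    qed
    then obtain v where v: "v \<in> joins_below b (g' \<squnion>\<^bsub>S'\<^esub> h')" "a \<sqsubseteq>\<^bsub>S\<^esub> v"
      using insert h' by (meson S'.join_closed insertCI)
    show ?thesis
    proof (cases "v = b")
      case True
      have "b \<in> joins_below b g'" "b \<in> joins_below b h'" by (auto simp: joins_below_def)
      moreover have "a \<sqsubseteq>\<^bsub>S\<^esub> b \<squnion>\<^bsub>S\<^esub> b" using v True car
        by (auto simp: S.le_join_iff intro: S.le_trans)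
      ultimately show ?thesis by blast
    next
      case False
      then obtain c where "v = b \<squnion>\<^bsub>S\<^esub> c" "(c, g' \<squnion>\<^bsub>S'\<^esub> h') \<in> R"
        using v unfolding joins_below_def by blast
      then show ?thesis
        using relative_binary_decomposition[OF car insert.prems(2) h'(1) ab] v by metis
    qed
  qed
  then obtain v w where vw: "\<And>h'. h' \<in> H' \<Longrightarrow> v h' \<in> joins_below b g'"
      "\<And>h'. h' \<in> H' \<Longrightarrow> w h' \<in> joins_below b h'" "\<And>h'. h' \<in> H' \<Longrightarrow> a \<sqsubseteq>\<^bsub>S\<^esub> v h' \<squnion>\<^bsub>S\<^esub> w h'"
    by metis
  have vc: "v h' \<in> carrier S" "w h' \<in> carrier S" if "h' \<in> H'" for h'
    using joins_below_closed(1)[OF car(2) vw(1)[OF that]]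
      joins_below_closed(1)[OF car(2) vw(2)[OF that]] by simp_all
  then have "\<exists>z\<in>joins_below b g'. \<forall>u\<in>v ` H'. u \<sqsubseteq>\<^bsub>S\<^esub> z"
    using vw H' S.le_refl by (intro joins_below_directed car) blast+
  then obtain z where z: "z \<in> joins_below b g'" "\<And>h'. h' \<in> H' \<Longrightarrow> v h' \<sqsubseteq>\<^bsub>S\<^esub> z" by blast
  have zc: "z \<in> carrier S" "b \<sqsubseteq>\<^bsub>S\<^esub> z" using z joins_below_closed car by auto
  have zw: "a \<sqsubseteq>\<^bsub>S\<^esub> z \<squnion>\<^bsub>S\<^esub> w h'" if "h' \<in> H'" for h'
    using that vc z(2) zc(1) car by (rule_tac S.le_join_mono[OF vw(3)]) auto
  have "a \<sqsubseteq>\<^bsub>S\<^esub> z"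
  \<comment> \<open>A part equal to \<open>b\<close> is absorbed by \<open>z\<close>. If no part is,
    each is \<open>b\<close> joined with an element related to \<open>h'\<close>, which is what
    relative complementation asks for.\<close>
  proof (cases "\<exists>h'\<in>H'. w h' = b")
    case True
    then have "a \<sqsubseteq>\<^bsub>S\<^esub> z \<squnion>\<^bsub>S\<^esub> b" using zw by metis
    then show ?thesis using zc car by (simp add: S.le_join_iff)
  next
    case False
    show ?thesis
    proof (rule H'(4)[OF zc])
      fix h' assume h': "h' \<in> H'"
      then obtain d where d: "w h' = b \<squnion>\<^bsub>S\<^esub> d" "(d, h') \<in> R"
        using False vw(2)[OF h'] unfolding joins_below_def by blast
      have "d \<in> carrier S" using d carriers by blast
      have "a \<sqsubseteq>\<^bsub>S\<^esub> z \<squnion>\<^bsub>S\<^esub> (b \<squnion>\<^bsub>S\<^esub> d)" using zw[OF h'] d by simp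
      then have "a \<sqsubseteq>\<^bsub>S\<^esub> z \<squnion>\<^bsub>S\<^esub> d"
        using zc car \<open>d \<in> carrier S\<close> S.le_join_absorb by blast
      with d show "\<exists>f. (f, h') \<in> R \<and> a \<sqsubseteq>\<^bsub>S\<^esub> z \<squnion>\<^bsub>S\<^esub> f" by blast
    qed
  qed
  with z show ?case by blast
qed

end

section \<open>Composition of \<or>-relations\<close>

lemma subfit_round_upper_semilattice:
  "subfit_round_semilattice S \<Longrightarrow> upper_semilattice S"
  by (simp add: subfit_round_semilattice_def vee_semilattice_def)

lemma vee_morphismI:
  assumes "subfit_round_semilattice S" "subfit_round_semilattice S'" "vee_relation S S' R"
  shows "vee_morphism S S' R"
  by (intro vee_morphism.intro vee_morphism_axioms.intro subfit_round_upper_semilattice assms)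

locale vee_composition =
  f: vee_morphism S S' R + g: vee_morphism S' S'' R'
  for S :: "('a, 'd) gorder_scheme" and S' :: "('b, 'e) gorder_scheme"
    and S'' :: "('c, 'f) gorder_scheme" and R R'
begin

lemma auxiliary_comp: "auxiliary S S'' (R O R')"
  unfolding auxiliary_def
proof (intro ballI impI, elim conjE)
  fix p q p'' q''
  assume car: "p \<in> carrier S" "p'' \<in> carrier S''"
    and le: "p \<sqsubseteq>\<^bsub>S\<^esub> q" "q'' \<sqsubseteq>\<^bsub>S''\<^esub> p''" and "(q, q'') \<in> R O R'"
  then obtain q' where q': "(q, q') \<in> R" "(q', q'') \<in> R'" by blast
  then have q'c: "q' \<in> carrier S'" using f.carriers by simp
  have "(p, q') \<in> R" using f.auxiliaryD[OF car(1) le(1) q'(1)] q'c by simp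
  moreover have "(q', p'') \<in> R'" using g.auxiliaryD[OF q'c _ q'(2) le(2) car(2)] q'c by simp
  ultimately show "(p, p'') \<in> R O R'" by blast
qed

text \<open>The intermediate elements \<open>p'\<close> and \<open>q'\<close> may differ; their join
  serves both sides, by (Auxiliary) for \<open>R\<close> and (\<or>-Preserving) for
  \<open>R'\<close>.\<close>

lemma vee_preserving_comp: "vee_preserving S S'' (R O R')"
  unfolding vee_preserving_def
proof (intro ballI impI, elim conjE)
  fix p q r''
  assume "(p, r'') \<in> R O R'" "(q, r'') \<in> R O R'"
  then obtain p' q' where pq: "(p, p') \<in> R" "(p', r'') \<in> R'" "(q, q') \<in> R" "(q', r'') \<in> R'"
    by blast
  then have car: "p \<in> carrier S" "q \<in> carrier S" "p' \<in> carrier S'" "q' \<in> carrier S'"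
    using f.carriers by simp_all
  have "(p, p' \<squnion>\<^bsub>S'\<^esub> q') \<in> R"
    using f.auxiliaryD[OF car(1) _ pq(1)] car f.S'.join_left by simp
  moreover have "(q, p' \<squnion>\<^bsub>S'\<^esub> q') \<in> R"
    using f.auxiliaryD[OF car(2) _ pq(3)] car f.S'.join_right by simp
  ultimately have "(p \<squnion>\<^bsub>S\<^esub> q, p' \<squnion>\<^bsub>S'\<^esub> q') \<in> R" by (rule f.preservingD)
  moreover have "(p' \<squnion>\<^bsub>S'\<^esub> q', r'') \<in> R'" using g.preservingD pq by simp
  ultimately show "(p \<squnion>\<^bsub>S\<^esub> q, r'') \<in> R O R'" by blast
qed

text \<open>From \<open>p' \<sqsubseteq> join_finite S' g' F'\<close> it follows that
  \<open>p\<close> is related to the join of \<open>insert g' F'\<close> and decomposes along this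
  set. Parts related to members of \<open>F'\<close> continue along \<open>R'\<close> and are kept;
  those related only to \<open>g'\<close> are removed for all \<open>g'\<close> at once by the
  complement property of \<open>G'\<close>.\<close>

lemma decomposition_comp: "decomposition S S'' (R O R')"
  unfolding decomposition_def
proof (intro ballI allI impI, elim conjE)
  fix p q F''
  assume car: "p \<in> carrier S" "q \<in> carrier S"
    and F'': "finite F''" "F'' \<subseteq> carrier S''" "F'' = {} \<longrightarrow> (\<exists>m. least S'' m (carrier S''))"
    and pq: "rather_below S p (p \<squnion>\<^bsub>S\<^esub> q)" and "(p, \<Squnion>\<^bsub>S''\<^esub>F'') \<in> R O R'"
  then obtain p' where p': "(p, p') \<in> R" "(p', \<Squnion>\<^bsub>S''\<^esub>F'') \<in> R'" by blast
  have p'c: "p' \<in> carrier S'" using p' f.carriers by simp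
  obtain q' where q': "q' \<in> carrier S'" "rather_below S' p' q'"
    using f.round(2) p'c unfolding round_semilattice_def by metis
  have "p \<sqsubseteq>\<^bsub>S\<^esub> q \<squnion>\<^bsub>S\<^esub> p" using car f.S.join_right by simp
  from f.relative_complementation[OF car q'(1) pq this p'(1)]
  obtain G' where G': "finite G'" "G' \<subseteq> carrier S'"
      "\<And>g'. g' \<in> G' \<Longrightarrow> q' \<sqsubseteq>\<^bsub>S'\<^esub> p' \<squnion>\<^bsub>S'\<^esub> g'"
      "\<And>v. \<lbrakk>v \<in> carrier S; q \<sqsubseteq>\<^bsub>S\<^esub> v; \<And>g'. g' \<in> G' \<Longrightarrow> \<exists>f. (f, g') \<in> R \<and> p \<sqsubseteq>\<^bsub>S\<^esub> v \<squnion>\<^bsub>S\<^esub> f\<rbrakk>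
        \<Longrightarrow> p \<sqsubseteq>\<^bsub>S\<^esub> v"
    by metis
  have "\<exists>F' F. refines R' F' F'' \<and> finite F \<and> F \<subseteq> carrier S \<and> refines R F (insert g' F') \<and>
      p \<sqsubseteq>\<^bsub>S\<^esub> join_finite S q F" if g': "g' \<in> G'" for g'
  proof -
    have g'c: "g' \<in> carrier S'" using g' G' by blast
    have "rather_below S' p' (p' \<squnion>\<^bsub>S'\<^esub> g')"
      using f.S'.rather_below_mono[OF q'(2) G'(3)[OF g']] p'c q'(1) g'c by simp
    from g.decompositionD[OF p'c g'c this F''(1,2) _ p'(2)] F''(3)
    obtain F' where F': "finite F'" "F' \<subseteq> carrier S'" "refines R' F' F''"
      "p' \<sqsubseteq>\<^bsub>S'\<^esub> join_finite S' g' F'"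
      by metis
    let ?I = "insert g' F'"
    \<comment> \<open>Containing \<open>g'\<close>, this set is nonempty even when \<open>F'\<close>
      is empty, so the guard on a minimum of \<open>S'\<close> holds vacuously.\<close>
    have I: "finite ?I" "?I \<subseteq> carrier S'" "?I \<noteq> {}" using F' g'c by auto
    have sup: "\<Squnion>\<^bsub>S'\<^esub>?I \<in> carrier S'" using I by (rule f.S'.finite_sup_closed)
    then have "\<forall>x\<in>?I. x \<sqsubseteq>\<^bsub>S'\<^esub> \<Squnion>\<^bsub>S'\<^esub>?I"
      using f.S'.Sup_le_iff[OF I sup] f.S'.le_refl by simp
    then have "p' \<sqsubseteq>\<^bsub>S'\<^esub> \<Squnion>\<^bsub>S'\<^esub>?I"
      using F' p'c g'c sup by (simp add: f.S'.le_join_finite_iff)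
    then have "(p, \<Squnion>\<^bsub>S'\<^esub>?I) \<in> R"
      using f.auxiliaryD[OF car(1) _ p'(1)] car sup by simp
    from f.decompositionD[OF car pq I(1,2) _ this]
    obtain F where "finite F" "F \<subseteq> carrier S" "refines R F ?I" "p \<sqsubseteq>\<^bsub>S\<^esub> join_finite S q F"
      by (metis insert_not_empty)
    with F'(3) show ?thesis by blast
  qed
  then obtain H' H where H': "\<And>g'. g' \<in> G' \<Longrightarrow> refines R' (H' g') F''"
    and H: "\<And>g'. g' \<in> G' \<Longrightarrow> finite (H g')" "\<And>g'. g' \<in> G' \<Longrightarrow> H g' \<subseteq> carrier S"
      "\<And>g'. g' \<in> G' \<Longrightarrow> refines R (H g') (insert g' (H' g'))"
      "\<And>g'. g' \<in> G' \<Longrightarrow> p \<sqsubseteq>\<^bsub>S\<^esub> join_finite S q (H g')"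
    by metis
  define F where "F = (\<Union>g'\<in>G'. {f \<in> H g'. \<exists>x'\<in>H' g'. (f, x') \<in> R})"
  have F: "finite F" "F \<subseteq> carrier S" using G'(1) H(1,2) unfolding F_def by auto
  have "p \<sqsubseteq>\<^bsub>S\<^esub> u" if u: "u \<in> carrier S" "q \<sqsubseteq>\<^bsub>S\<^esub> u" "\<forall>f\<in>F. f \<sqsubseteq>\<^bsub>S\<^esub> u" for u
  proof (rule ccontr)
    assume nle: "\<not> p \<sqsubseteq>\<^bsub>S\<^esub> u"
    have "\<exists>c. (c, g') \<in> R \<and> p \<sqsubseteq>\<^bsub>S\<^esub> u \<squnion>\<^bsub>S\<^esub> c" if g': "g' \<in> G'" for g'
    proof -
      \<comment> \<open>The parts related to \<open>g'\<close> lie below \<open>v\<close> and the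
        kept ones below \<open>u\<close>, so \<open>v\<close> bounds the whole decomposition of
        \<open>p\<close>. Since \<open>p\<close> is not below \<open>u\<close>, \<open>v\<close> is
        not the base point and thus stems from an element related to \<open>g'\<close>.\<close>
      obtain v where v: "v \<in> f.joins_below u g'" "\<And>f. f \<in> H g' \<Longrightarrow> (f, g') \<in> R \<Longrightarrow> f \<sqsubseteq>\<^bsub>S\<^esub> v"
        using f.joins_below_bound[OF u(1) H(1)[OF g'], of g'] by metis
      have vc: "v \<in> carrier S" "u \<sqsubseteq>\<^bsub>S\<^esub> v" using f.joins_below_closed[OF u(1) v(1)] by auto
      have "f \<sqsubseteq>\<^bsub>S\<^esub> v" if f: "f \<in> H g'" for f
      proof (cases "(f, g') \<in> R")
        case True
        then show ?thesis using v f by simp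
      next
        case False
        then have "f \<in> F" using H(3)[OF g'] f g' unfolding F_def refines_def by blast
        then have "f \<sqsubseteq>\<^bsub>S\<^esub> u" "f \<in> carrier S" using u F by auto
        then show ?thesis using f.S.le_trans[OF _ vc(2)] u vc by simp
      qed
      moreover have "q \<sqsubseteq>\<^bsub>S\<^esub> v" using f.S.le_trans[OF u(2) vc(2)] car u vc by simp
      ultimately have "p \<sqsubseteq>\<^bsub>S\<^esub> v"
        using H(4)[OF g'] f.S.le_join_finite_iff[OF car H(1,2)[OF g']] vc by simp
      then show ?thesis using nle v(1) unfolding f.joins_below_def by blast
    qed
    then have "p \<sqsubseteq>\<^bsub>S\<^esub> u" by (rule G'(4)[OF u(1,2)])
    with nle show False ..
  qed
  then have "p \<sqsubseteq>\<^bsub>S\<^esub> join_finite S q F" using F car by (simp add: f.S.le_join_finite_iff)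
  moreover have "refines (R O R') F F''"
    unfolding refines_def
  proof
    fix f assume "f \<in> F"
    then obtain g' x' where "g' \<in> G'" "x' \<in> H' g'" "(f, x') \<in> R" unfolding F_def by blast
    then show "\<exists>f''\<in>F''. (f, f'') \<in> R O R'" using H' unfolding refines_def by blast
  qed
  ultimately show "\<exists>F. finite F \<and> F \<subseteq> carrier S \<and> refines (R O R') F F'' \<and> p \<sqsubseteq>\<^bsub>S\<^esub> join_finite S q F"
    using F by blast
qed

text \<open>Two complementations are nested: \<open>G'\<close> along \<open>R\<close>, and over each
  \<open>g'\<close> in \<open>G'\<close> a set \<open>H'' g'\<close> along \<open>R'\<close>; the
  union of the latter is the witness. If it corefines \<open>F\<close>, the intermediate elements
  together with \<open>p'\<close> have formal meet below each \<open>g'\<close>. Lifting these meets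
  gives elements related to each \<open>g'\<close>, to which (Complementation) of \<open>R\<close>
  applies.\<close>

lemma complementation_comp: "complementation S S'' (R O R')"
  unfolding complementation_def
proof (intro ballI impI, elim conjE)
  fix p q p'' q''
  assume car: "p \<in> carrier S" "q \<in> carrier S" "p'' \<in> carrier S''" "q'' \<in> carrier S''"
    and pq: "rather_below S p (p \<squnion>\<^bsub>S\<^esub> q)" and "(p, p'') \<in> R O R'"
  then obtain p' where p': "(p, p') \<in> R" "(p', p'') \<in> R'" by blast
  have p'c: "p' \<in> carrier S'" using p' f.carriers by simp
  obtain q' where q': "q' \<in> carrier S'" "rather_below S' p' q'"
    using f.round(2) p'c unfolding round_semilattice_def by metis
  from f.complementationD[OF pq p'(1) car(2) q'(1)]
  obtain G' where G': "finite G'" "G' \<subseteq> carrier S'"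
      "\<And>g'. g' \<in> G' \<Longrightarrow> q' \<sqsubseteq>\<^bsub>S'\<^esub> p' \<squnion>\<^bsub>S'\<^esub> g'"
      "\<And>F. \<lbrakk>finite F; F \<subseteq> carrier S; corefines R G' F\<rbrakk> \<Longrightarrow> formal_meet_le S (F \<union> {p}) q"
    by metis
  have "\<exists>F''. finite F'' \<and> F'' \<subseteq> carrier S'' \<and> (\<forall>f''\<in>F''. q'' \<sqsubseteq>\<^bsub>S''\<^esub> p'' \<squnion>\<^bsub>S''\<^esub> f'') \<and>
      (\<forall>F'. finite F' \<longrightarrow> F' \<subseteq> carrier S' \<longrightarrow> corefines R' F'' F' \<longrightarrow>
        formal_meet_le S' (F' \<union> {p'}) g')" if g': "g' \<in> G'" for g'
  proof -
    have g'c: "g' \<in> carrier S'" using g' G' by blast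
    have "rather_below S' p' (p' \<squnion>\<^bsub>S'\<^esub> g')"
      using f.S'.rather_below_mono[OF q'(2) G'(3)[OF g']] p'c q'(1) g'c by simp
    from g.complementationD[OF this p'(2) g'c car(4)]
    obtain F'' where "finite F''" "F'' \<subseteq> carrier S''"
      "\<And>f''. f'' \<in> F'' \<Longrightarrow> q'' \<sqsubseteq>\<^bsub>S''\<^esub> p'' \<squnion>\<^bsub>S''\<^esub> f''"
      "\<And>F'. \<lbrakk>finite F'; F' \<subseteq> carrier S'; corefines R' F'' F'\<rbrakk>
        \<Longrightarrow> formal_meet_le S' (F' \<union> {p'}) g'"
      by metis
    then show ?thesis by metis
  qed
  then obtain H'' where H'': "\<And>g'. g' \<in> G' \<Longrightarrow> finite (H'' g')" "\<And>g'. g' \<in> G' \<Longrightarrow> H'' g' \<subseteq> carrier S''"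
      "\<And>g' f''. g' \<in> G' \<Longrightarrow> f'' \<in> H'' g' \<Longrightarrow> q'' \<sqsubseteq>\<^bsub>S''\<^esub> p'' \<squnion>\<^bsub>S''\<^esub> f''"
      "\<And>g' F'. g' \<in> G' \<Longrightarrow> finite F' \<Longrightarrow> F' \<subseteq> carrier S' \<Longrightarrow> corefines R' (H'' g') F'
        \<Longrightarrow> formal_meet_le S' (F' \<union> {p'}) g'"
    by metis
  define F'' where "F'' = (\<Union>g'\<in>G'. H'' g')"
  have "formal_meet_le S (F \<union> {p}) q"
    if F: "finite F" "F \<subseteq> carrier S" "corefines (R O R') F'' F" for F
    unfolding formal_meet_le_def
  proof (intro ballI impI)
    fix a b assume ab: "a \<in> carrier S" "b \<in> carrier S" "\<forall>e\<in>F \<union> {p}. a \<sqsubseteq>\<^bsub>S\<^esub> b \<squnion>\<^bsub>S\<^esub> e"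
    show "a \<sqsubseteq>\<^bsub>S\<^esub> b \<squnion>\<^bsub>S\<^esub> q"
    proof (rule ccontr)
      assume nle: "\<not> a \<sqsubseteq>\<^bsub>S\<^esub> b \<squnion>\<^bsub>S\<^esub> q"
      have "subfit S" using f.subfit_round(1) unfolding subfit_round_semilattice_def by blast
      \<comment> \<open>Lifting a meet requires a base \<open>b'\<close> with
        \<open>a \<prec> a \<or> b'\<close>, which an arbitrary \<open>b\<close> does not provide;
        failure of the claim supplies one above \<open>b \<squnion> q\<close>. As \<open>a\<close>
        is not below \<open>b'\<close>, the lifted cover cannot be the base point.\<close>
      from f.S.subfit_witness[OF this f.round(1) ab(1) _ nle] ab(2) car(2)
      obtain b' where b': "b' \<in> carrier S" "b \<squnion>\<^bsub>S\<^esub> q \<sqsubseteq>\<^bsub>S\<^esub> b'"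
        "rather_below S a (a \<squnion>\<^bsub>S\<^esub> b')" "\<not> a \<sqsubseteq>\<^bsub>S\<^esub> b'"
        by (metis f.S.join_closed)
      have bq: "b \<sqsubseteq>\<^bsub>S\<^esub> b'" "q \<sqsubseteq>\<^bsub>S\<^esub> b'" using b'(1,2) ab car by (simp_all add: f.S.join_le_iff)
      have ab': "a \<sqsubseteq>\<^bsub>S\<^esub> b' \<squnion>\<^bsub>S\<^esub> e" if "e \<in> F \<union> {p}" for e
      proof (rule f.S.le_join_mono[OF _ bq(1)])
        show "e \<in> carrier S" using that F car by auto
        then show "e \<sqsubseteq>\<^bsub>S\<^esub> e" by simp
      qed (use that ab b' F car in auto)
      have "\<exists>c. (c, g') \<in> R \<and> a \<sqsubseteq>\<^bsub>S\<^esub> b' \<squnion>\<^bsub>S\<^esub> c" if g': "g' \<in> G'" for g'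
      proof -
        have "\<exists>x' f. f \<in> F \<and> (f, x') \<in> R \<and> (x', h'') \<in> R'" if "h'' \<in> H'' g'" for h''
          using F(3) that g' unfolding corefines_def F''_def by blast
        then obtain x f where xf: "\<And>h''. h'' \<in> H'' g' \<Longrightarrow> f h'' \<in> F"
            "\<And>h''. h'' \<in> H'' g' \<Longrightarrow> (f h'', x h'') \<in> R"
            "\<And>h''. h'' \<in> H'' g' \<Longrightarrow> (x h'', h'') \<in> R'"
          by metis
        let ?X = "x ` H'' g' \<union> {p'}"
        have "finite (x ` H'' g')" "x ` H'' g' \<subseteq> carrier S'" "corefines R' (H'' g') (x ` H'' g')"
          using H''(1)[OF g'] f.carriers(2)[OF xf(2)] xf(3) unfolding corefines_def by auto
        then have meet: "formal_meet_le S' ?X g'" by (rule H''(4)[OF g'])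
        have X: "finite ?X" "?X \<noteq> {}" using H''(1)[OF g'] by auto
        have "\<exists>f. (f, x') \<in> R \<and> a \<sqsubseteq>\<^bsub>S\<^esub> b' \<squnion>\<^bsub>S\<^esub> f" if "x' \<in> ?X" for x'
          using that xf p'(1) ab' by blast
        moreover have "g' \<in> carrier S'" using g' G' by blast
        ultimately have "\<exists>v\<in>f.joins_below b' g'. a \<sqsubseteq>\<^bsub>S\<^esub> v"
          using meet by (rule f.formal_meet_lift[OF X ab(1) b'(1,3)])
        then show ?thesis using b'(4) unfolding f.joins_below_def by blast
      qed
      then obtain c where c: "\<And>g'. g' \<in> G' \<Longrightarrow> (c g', g') \<in> R"
          "\<And>g'. g' \<in> G' \<Longrightarrow> a \<sqsubseteq>\<^bsub>S\<^esub> b' \<squnion>\<^bsub>S\<^esub> c g'"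
        by metis
      have "formal_meet_le S (c ` G' \<union> {p}) q"
        using G'(1) c(1) f.carriers(1) by (intro G'(4)) (auto simp: corefines_def)
      then have "a \<sqsubseteq>\<^bsub>S\<^esub> b' \<squnion>\<^bsub>S\<^esub> q"
        using ab(1) b'(1) by (rule formal_meet_leD) (use c(2) ab' in auto)
      then have "a \<sqsubseteq>\<^bsub>S\<^esub> b'"
        using f.S.le_join_le[OF _ _ bq(2)] ab(1) b'(1) car(2) by simp
      with b'(4) show False ..
    qed
  qed
  moreover have "F'' \<subseteq> carrier S''" using H''(2) unfolding F''_def by blast
  moreover have "finite F''" "\<forall>f''\<in>F''. q'' \<sqsubseteq>\<^bsub>S''\<^esub> p'' \<squnion>\<^bsub>S''\<^esub> f''"
    using G'(1) H''(1,3) unfolding F''_def by auto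
  ultimately show "\<exists>F''. finite F'' \<and> F'' \<subseteq> carrier S'' \<and> (\<forall>f''\<in>F''. q'' \<sqsubseteq>\<^bsub>S''\<^esub> p'' \<squnion>\<^bsub>S''\<^esub> f'') \<and>
      (\<forall>F. finite F \<and> F \<subseteq> carrier S \<and> corefines (R O R') F'' F \<longrightarrow> formal_meet_le S (F \<union> {p}) q)"
    by metis
qed

lemma vee_relation_comp: "vee_relation S S'' (R O R')"
  unfolding vee_relation_def
  using f.carriers g.carriers auxiliary_comp vee_preserving_comp decomposition_comp
    complementation_comp by blast

end

lemma vee_relation_relcomp:
  assumes "subfit_round_semilattice S" "subfit_round_semilattice S'" "subfit_round_semilattice S''"
    and "vee_relation S S' R" "vee_relation S' S'' R'"
  shows "vee_relation S S'' (R O R')"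
proof -
  interpret vee_composition S S' S'' R R'
    using assms by (intro vee_composition.intro vee_morphismI)
  show ?thesis by (rule vee_relation_comp)
qed

section \<open>The order relation as identity morphism\<close>

text \<open>In (Decomposition) the set \<open>F'\<close> decomposes itself. For (Complementation),
  \<open>p \<sqsubseteq> p'\<close> makes \<open>p'\<close> a cover of the pair \<open>p\<close>,
  \<open>q\<close>, and its complement inside \<open>q'\<close> is the required set.\<close>

lemma vee_relation_order_rel:
  assumes "subfit_round_semilattice S"
  shows "vee_relation S S (order_rel S)"
proof -
  interpret upper_semilattice S using assms by (rule subfit_round_upper_semilattice)
  have "auxiliary S S (order_rel S)"
    unfolding auxiliary_def order_rel_def by (auto intro: le_trans)
  moreover have "vee_preserving S S (order_rel S)"
    unfolding vee_preserving_def order_rel_def by (auto simp: join_le_iff)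
  moreover have "decomposition S S (order_rel S)"
    unfolding decomposition_def
  proof (intro ballI allI impI, elim conjE)
    fix p q F'
    assume car: "p \<in> carrier S" "q \<in> carrier S" and F': "finite F'" "F' \<subseteq> carrier S"
      and bot: "F' = {} \<longrightarrow> (\<exists>m. least S m (carrier S))"
      and "(p, \<Squnion>\<^bsub>S\<^esub>F') \<in> order_rel S"
    then have le: "p \<sqsubseteq>\<^bsub>S\<^esub> \<Squnion>\<^bsub>S\<^esub>F'" by (simp add: order_rel_def)
    have "p \<sqsubseteq>\<^bsub>S\<^esub> u" if u: "u \<in> carrier S" "q \<sqsubseteq>\<^bsub>S\<^esub> u" "\<forall>f\<in>F'. f \<sqsubseteq>\<^bsub>S\<^esub> u" for u
    proof (cases "F' = {}")
      case True
      then obtain m where "least S m (carrier S)" using bot by blast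
      \<comment> \<open>Every element bounds the empty set, so a minimum is a candidate for the
        choice operator behind the empty supremum.\<close>
      then have "least S m (Upper S {})" by simp
      then have "least S (\<Squnion>\<^bsub>S\<^esub>{}) (Upper S {})" unfolding sup_def by (rule someI)
      then have sup: "\<Squnion>\<^bsub>S\<^esub>{} \<in> carrier S" "\<Squnion>\<^bsub>S\<^esub>{} \<sqsubseteq>\<^bsub>S\<^esub> u"
        using u by (simp_all add: least_def)
      show ?thesis by (rule le_trans[OF le[unfolded True] sup(2) car(1) sup(1) u(1)])
    next
      case False
      then have "\<Squnion>\<^bsub>S\<^esub>F' \<in> carrier S" "\<Squnion>\<^bsub>S\<^esub>F' \<sqsubseteq>\<^bsub>S\<^esub> u"
        using F' u by (simp_all add: Sup_le_iff)
      then show ?thesis using le_trans[OF le] car u by simp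
    qed
    then have "p \<sqsubseteq>\<^bsub>S\<^esub> join_finite S q F'" using F' car by (simp add: le_join_finite_iff)
    moreover have "refines (order_rel S) F' F'"
      using F' le_refl unfolding refines_def order_rel_def by blast
    ultimately show "\<exists>F. finite F \<and> F \<subseteq> carrier S \<and> refines (order_rel S) F F' \<and>
        p \<sqsubseteq>\<^bsub>S\<^esub> join_finite S q F"
      using F' by blast
  qed
  moreover have "complementation S S (order_rel S)"
    unfolding complementation_def
  proof (intro ballI impI, elim conjE)
    fix p q p' q'
    assume car: "p \<in> carrier S" "q \<in> carrier S" "p' \<in> carrier S" "q' \<in> carrier S"
      and pq: "rather_below S p (p \<squnion>\<^bsub>S\<^esub> q)" and "(p, p') \<in> order_rel S"
    then have le: "p \<sqsubseteq>\<^bsub>S\<^esub> p'" by (simp add: order_rel_def)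
    have "p \<sqsubseteq>\<^bsub>S\<^esub> q \<squnion>\<^bsub>S\<^esub> p'" using le car by (auto simp: le_join_iff intro: le_trans)
    from complement_cover[OF car pq this]
    obtain F' where F': "finite F'" "F' \<subseteq> carrier S"
      "\<And>f'. f' \<in> F' \<Longrightarrow> q' \<sqsubseteq>\<^bsub>S\<^esub> p' \<squnion>\<^bsub>S\<^esub> f'"
      "\<And>a v. \<lbrakk>a \<in> carrier S; v \<in> carrier S; q \<sqsubseteq>\<^bsub>S\<^esub> v; a \<sqsubseteq>\<^bsub>S\<^esub> v \<squnion>\<^bsub>S\<^esub> p;
        \<And>f'. f' \<in> F' \<Longrightarrow> a \<sqsubseteq>\<^bsub>S\<^esub> v \<squnion>\<^bsub>S\<^esub> f'\<rbrakk> \<Longrightarrow> a \<sqsubseteq>\<^bsub>S\<^esub> v"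
      by blast
    have "formal_meet_le S (F \<union> {p}) q"
      if F: "F \<subseteq> carrier S" "corefines (order_rel S) F' F" for F
      unfolding formal_meet_le_def
    proof (intro ballI impI)
      fix a b assume ab: "a \<in> carrier S" "b \<in> carrier S" "\<forall>e\<in>F \<union> {p}. a \<sqsubseteq>\<^bsub>S\<^esub> b \<squnion>\<^bsub>S\<^esub> e"
      have weaken: "a \<sqsubseteq>\<^bsub>S\<^esub> b \<squnion>\<^bsub>S\<^esub> q \<squnion>\<^bsub>S\<^esub> e'"
        if "e \<in> F \<union> {p}" "e \<in> carrier S" "e' \<in> carrier S" "e \<sqsubseteq>\<^bsub>S\<^esub> e'" for e e'
      proof (rule le_join_mono[of a b e])
        show "a \<sqsubseteq>\<^bsub>S\<^esub> b \<squnion>\<^bsub>S\<^esub> e" using ab(3) that(1) by blast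
      qed (use that ab car join_left in auto)
      show "a \<sqsubseteq>\<^bsub>S\<^esub> b \<squnion>\<^bsub>S\<^esub> q"
      \<comment> \<open>The complement property speaks of bases above \<open>q\<close>; it is used
        at \<open>v = b \<squnion> q\<close>, to which \<open>weaken\<close> has carried the covers
        of \<open>a\<close>.\<close>
      proof (rule F'(4))
        show "a \<sqsubseteq>\<^bsub>S\<^esub> b \<squnion>\<^bsub>S\<^esub> q \<squnion>\<^bsub>S\<^esub> p" using weaken[of p p] car by simp
      next
        fix f' assume "f' \<in> F'"
        then obtain f where "f \<in> F" "f \<in> carrier S" "f' \<in> carrier S" "f \<sqsubseteq>\<^bsub>S\<^esub> f'"
          using F(2) unfolding corefines_def order_rel_def by blast
        then show "a \<sqsubseteq>\<^bsub>S\<^esub> b \<squnion>\<^bsub>S\<^esub> q \<squnion>\<^bsub>S\<^esub> f'" using weaken[of f f'] by simp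
      qed (use ab car join_right in auto)
    qed
    with F'(1-3) show "\<exists>F'. finite F' \<and> F' \<subseteq> carrier S \<and> (\<forall>f'\<in>F'. q' \<sqsubseteq>\<^bsub>S\<^esub> p' \<squnion>\<^bsub>S\<^esub> f') \<and>
        (\<forall>F. finite F \<and> F \<subseteq> carrier S \<and> corefines (order_rel S) F' F \<longrightarrow>
          formal_meet_le S (F \<union> {p}) q)"
      by meson
  qed
  moreover have "order_rel S \<subseteq> carrier S \<times> carrier S" by (auto simp: order_rel_def)
  ultimately show ?thesis unfolding vee_relation_def by blast
qed

lemma order_rel_relcomp:
  assumes "subfit_round_semilattice S" "subfit_round_semilattice S'" "vee_relation S S' R"
  shows "order_rel S O R = R" "R O order_rel S' = R"
proof -
  interpret S: upper_semilattice S by (rule subfit_round_upper_semilattice) fact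
  interpret S': upper_semilattice S' by (rule subfit_round_upper_semilattice) fact
  have R: "R \<subseteq> carrier S \<times> carrier S'" and aux: "auxiliary S S' R"
    using assms(3) by (auto simp: vee_relation_def)
  show "order_rel S O R = R"
  proof (intro equalityI subrelI)
    fix p p' assume "(p, p') \<in> order_rel S O R"
    then obtain q where "p \<in> carrier S" "q \<in> carrier S" "p \<sqsubseteq>\<^bsub>S\<^esub> q" "(q, p') \<in> R" "p' \<in> carrier S'"
      using R unfolding order_rel_def by blast
    then show "(p, p') \<in> R" using aux S'.le_refl unfolding auxiliary_def by metis
  next
    fix p p' assume "(p, p') \<in> R"
    moreover from this have "(p, p) \<in> order_rel S" using R unfolding order_rel_def by auto
    ultimately show "(p, p') \<in> order_rel S O R" by blast
  qed
  show "R O order_rel S' = R"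
  proof (intro equalityI subrelI)
    fix p p' assume "(p, p') \<in> R O order_rel S'"
    then obtain q' where "p \<in> carrier S" "q' \<in> carrier S'" "q' \<sqsubseteq>\<^bsub>S'\<^esub> p'" "(p, q') \<in> R" "p' \<in> carrier S'"
      using R unfolding order_rel_def by blast
    then show "(p, p') \<in> R" using aux S.le_refl unfolding auxiliary_def by metis
  next
    fix p p' assume "(p, p') \<in> R"
    moreover from this have "(p', p') \<in> order_rel S'" using R unfolding order_rel_def by auto
    ultimately show "(p, p') \<in> R O order_rel S'" by blast
  qed
qed

theorem theorem8p7:
  shows
    "is_category {S :: 'a gorder. subfit_round_semilattice S}
       (\<lambda>S S'. {R. vee_relation S S' R}) order_rel (\<lambda>R R'. R O R') \<and>
     (\<forall>(S :: 'a gorder) (S' :: 'b gorder) (S'' :: 'c gorder) R R'.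
        subfit_round_semilattice S \<and> subfit_round_semilattice S' \<and>
        subfit_round_semilattice S'' \<and> vee_relation S S' R \<and> vee_relation S' S'' R' \<longrightarrow>
          vee_relation S S''
            {(s, s''). s \<in> carrier S \<and> s'' \<in> carrier S'' \<and>
               (\<exists>s'\<in>carrier S'. (s, s') \<in> R \<and> (s', s'') \<in> R')}) \<and>
     (\<forall>S :: 'a gorder. subfit_round_semilattice S \<longrightarrow> vee_relation S S (order_rel S)) \<and>
     (\<forall>(S :: 'a gorder) (S' :: 'b gorder) R.
        subfit_round_semilattice S \<and> subfit_round_semilattice S' \<and> vee_relation S S' R \<longrightarrow>
          order_rel S O R = R \<and> R O order_rel S' = R)"
proof (intro conjI allI impI, goal_cases)
  case 1
  show ?case
    unfolding is_category_def
    by (intro conjI ballI; simp only: mem_Collect_eq)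
      (rule vee_relation_order_rel vee_relation_relcomp order_rel_relcomp O_assoc; assumption)+
next
  case (2 S S' S'' R R')
  \<comment> \<open>\<open>R\<close> lies in the product of the carriers, so every intermediate
    element is in the carrier of \<open>S'\<close> and the set is the relational composite.\<close>
  then have "{(s, s''). s \<in> carrier S \<and> s'' \<in> carrier S'' \<and>
      (\<exists>s'\<in>carrier S'. (s, s') \<in> R \<and> (s', s'') \<in> R')} = R O R'"
    unfolding vee_relation_def by blast
  with 2 show ?case using vee_relation_relcomp by metis
next
  case (3 S)
  then show ?case by (rule vee_relation_order_rel)
next
  case (4 S S' R)
  then show ?case using order_rel_relcomp(1) by metis
next
  case (5 S S' R)
  then show ?case using order_rel_relcomp(2) by metis
qed

end
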